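(* Consider the transmission gain vector that minimizes the Kalman-filter mean squared error at the fusion center under the sum power constraint $\mathbf a_n^H\mathbf D\mathbf a_n\le P_T$, namely $$\mathbf a_n^*=\sqrt{\frac{P_T}{\mathbf h_n^H\mathbf B^{-1}\mathbf D\mathbf B^{-1}\mathbf h_n}}\;\mathbf B^{-1}\mathbf h_n,\qquad \mathbf B=\mathbf H_n\mathbf V\mathbf H_n^H+\frac{\sigma_w^2}{P_T}\mathbf D ,$$ with all symbols as defined in the context. (i) (High SNR at the fusion center.) The inequality $$\mathbf h_n^H\mathbf B^{-1}\mathbf h_n<\mathbf h_n^H(\mathbf H_n\mathbf V\mathbf H_n^H)^{-1}\mathbf h_n=\sum_{i=1}^N\frac{1}{\sigma_{v,i}^2}$$ becomes an equality when $\sigma_w^2/P_T\to 0$, i.e. when the signal-to-noise ratio (SNR) at the fusion center is very high, and the resulting optimal sensor transmission gains become $$\mathbf a_n^*=\sqrt{\frac{P_T}{\sum_{i=1}^N\frac{1}{\sigma_{v,i}^4|h_{i,n}|^2(\sigma_\theta^2+\sigma_{v,i}^2)}}}\;\left[\frac{1}{h_{1,n}\sigma_{v,1}^2},\dots,\frac{1}{h_{N,n}\sigma_{v,N}^2}\right]^H .$$ In this case, sensors with small channel gains or low measurement noise are allocated more transmit power. (ii) (Low SNR at the fusion center.) When $\sigma_w^2/P_T\to\infty$, one has $\mathbf B\approx\frac{\sigma_w^2}{P_T}\mathbf D$, and hence the optimal gain vector is proportional to $$\mathbf a_n^*\propto\left[\frac{h_{1,n}}{\sigma_\theta^2+\sigma_{v,1}^2},\dots,\frac{h_{N,n}}{\sigma_\theta^2+\sigma_{v,N}^2}\right]^H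 .$$ In this case, sensors with large channel gains are assigned higher power.
   Context: $N$ sensors observe a zero-mean complex parameter $\theta_n$ of variance $\sigma_\theta^2$; sensor $i$ measures $\theta_n+v_{i,n}$ with $v_{i,n}\sim\mathcal{CN}(0,\sigma_{v,i}^2)$, multiplies its measurement by a complex gain $a_{i,n}$, and transmits over a channel with complex gain $h_{i,n}$ to a fusion center, which receives the sum of all the transmissions plus noise of distribution $\mathcal{CN}(0,\sigma_w^2)$ and tracks $\theta_n$ with a Kalman filter. Here $(\cdot)^T$ and $(\cdot)^H$ denote transpose and conjugate transpose, $\mathbf a_n=[a_{1,n},\dots,a_{N,n}]^H$ contains the conjugates of the gains, $\mathbf h_n=[h_{1,n},\dots,h_{N,n}]^T$, $\mathbf H_n=\mathrm{diag}\{h_{1,n},\dots,h_{N,n}\}$, $\mathbf V=\mathrm{diag}\{\sigma_{v,1}^2,\dots,\sigma_{v,N}^2\}$, $\mathbf D=\mathrm{diag}\{\sigma_\theta^2+\sigma_{v,1}^2,\dots,\sigma_\theta^2+\sigma_{v,N}^2\}$, and $P_T$ is the total available transmit power, $\mathbf a_n^H\mathbf D\mathbf a_n$ being the actual sum transmit power.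
   Formalization: In (i) the factor σ_θ²+σ_{v,i}² in the normalizing sum is moved from the denominator to the numerator, and in (ii) the direction vector carries T instead of H (entries h_{i,n}, not conjugated); both formulas are false as printed. *)

theory Defs
  imports "HOL-Analysis.Analysis" "HOL-Library.Landau_Symbols" "HOL-Library.Complex_Order"
begin

text \<open>
  Sensors are indexed by a finite type, and everything refers to one time step. The gain vector
  \<open>a\<close> stands for the column vector whose entries are the conjugates of the sensor gains, so
  that \<open>hdot a y\<close> (that is, a^H y) is the plain sum of the products gain times \<open>y\<close>.
  The parameters \<open>st\<close>, \<open>sv $ i\<close>, \<open>sw\<close> are standard deviations; their squares are the
  variances of the parameter, of the measurement noises and of the fusion center noise.
  On complex numbers \<open>\<le>\<close> and \<open><\<close> compare real parts and require equal imaginary parts,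
  so an inequality against a real number includes the claim that the other side is real.
\<close>

definition hdot :: "complex^'n \<Rightarrow> complex^'n \<Rightarrow> complex" where
  "hdot x y = (\<Sum>i\<in>UNIV. cnj (x $ i) * y $ i)"

definition conj_transpose :: "complex^'n^'m \<Rightarrow> complex^'m^'n" where
  "conj_transpose A = (\<chi> i j. cnj (A $ j $ i))"

definition diag_mat :: "complex^'n \<Rightarrow> complex^'n^'n" where
  "diag_mat d = (\<chi> i j. if i = j then d $ i else 0)"

definition V_mat :: "real^'n \<Rightarrow> complex^'n^'n" where
  "V_mat sv = diag_mat (\<chi> i. of_real ((sv $ i)\<^sup>2))"

definition D_mat :: "real \<Rightarrow> real^'n \<Rightarrow> complex^'n^'n" where
  "D_mat st sv = diag_mat (\<chi> i. of_real (st\<^sup>2 + (sv $ i)\<^sup>2))"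

definition HVH_mat :: "real^'n \<Rightarrow> complex^'n \<Rightarrow> complex^'n^'n" where
  "HVH_mat sv h = diag_mat h ** V_mat sv ** conj_transpose (diag_mat h)"

definition B_mat :: "real \<Rightarrow> real^'n \<Rightarrow> complex^'n \<Rightarrow> real \<Rightarrow> real \<Rightarrow> complex^'n^'n" where
  "B_mat st sv h sw PT = HVH_mat sv h + (sw\<^sup>2 / PT) *\<^sub>R D_mat st sv"

definition sum_power :: "real \<Rightarrow> real^'n \<Rightarrow> complex^'n \<Rightarrow> complex" where
  "sum_power st sv a = hdot a (D_mat st sv *v a)"

text \<open>
  The transmit power of one sensor: the mean square of its gain times its measurement.
  These powers add up to \<^const>\<open>sum_power\<close>.
\<close>
definition sensor_power :: "real \<Rightarrow> real^'n \<Rightarrow> complex^'n \<Rightarrow> 'n \<Rightarrow> real" where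
  "sensor_power st sv a i = (cmod (a $ i))\<^sup>2 * (st\<^sup>2 + (sv $ i)\<^sup>2)"

text \<open>
  Kalman measurement update for the scalar observation y = c * theta + e, where theta has
  prediction error variance \<open>p\<close> and the noise e has variance \<open>r\<close>: the gain, and the error
  variance of the estimate corrected by \<open>k\<close> times the innovation.
\<close>
definition kalman_gain :: "real \<Rightarrow> complex \<Rightarrow> real \<Rightarrow> complex" where
  "kalman_gain p c r = of_real p * cnj c / of_real ((cmod c)\<^sup>2 * p + r)"

definition update_mse :: "real \<Rightarrow> complex \<Rightarrow> real \<Rightarrow> complex \<Rightarrow> real" where
  "update_mse p c r k = (cmod (1 - k * c))\<^sup>2 * p + (cmod k)\<^sup>2 * r"

text \<open>
  The fusion center receives y = (a^H h) theta + a^H H v + w. The quadratic form under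
  \<^const>\<open>Re\<close> is real.
\<close>
definition kalman_mse ::
  "real^'n \<Rightarrow> complex^'n \<Rightarrow> real \<Rightarrow> real \<Rightarrow> complex^'n \<Rightarrow> real" where
  "kalman_mse sv h sw p a =
     (let c = hdot a h; r = Re (hdot a (HVH_mat sv h *v a)) + sw\<^sup>2
      in update_mse p c r (kalman_gain p c r))"

definition opt_gain ::
  "real \<Rightarrow> real^'n \<Rightarrow> complex^'n \<Rightarrow> real \<Rightarrow> real \<Rightarrow> complex^'n" where
  "opt_gain st sv h sw PT =
     (let Binv = matrix_inv (B_mat st sv h sw PT)
      in sqrt (PT / Re (hdot h ((Binv ** D_mat st sv ** Binv) *v h))) *\<^sub>R (Binv *v h))"

text \<open>
  High-SNR gains. In the normalization, the factor \<open>st\<^sup>2 + (sv $ i)\<^sup>2\<close> belongs in the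
  numerator: the sum is h^H G D G h for G the inverse of H V H^H, and only so does the sum
  power equal \<open>PT\<close>.
\<close>
definition high_snr_gain ::
  "real \<Rightarrow> real^'n \<Rightarrow> complex^'n \<Rightarrow> real \<Rightarrow> complex^'n" where
  "high_snr_gain st sv h PT =
     sqrt (PT / (\<Sum>i\<in>UNIV. (st\<^sup>2 + (sv $ i)\<^sup>2) / ((sv $ i) ^ 4 * (cmod (h $ i))\<^sup>2)))
       *\<^sub>R (\<chi> i. cnj (1 / (h $ i * of_real ((sv $ i)\<^sup>2))))"

text \<open>
  Low-SNR direction: the inverse of D applied to h. Its entries carry h itself, not its
  conjugate; the sensor gains, being conjugates of the entries, are proportional to
  \<open>cnj (h $ i) / (st\<^sup>2 + (sv $ i)\<^sup>2)\<close>.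
\<close>
definition low_snr_direction :: "real \<Rightarrow> real^'n \<Rightarrow> complex^'n \<Rightarrow> complex^'n" where
  "low_snr_direction st sv h = (\<chi> i. h $ i / of_real (st\<^sup>2 + (sv $ i)\<^sup>2))"

end

theory Submission
  imports Defs
begin

text \<open>
  All matrices are diagonal. For fixed power, the error variance is decreasing in |c|^2 / r, where
  c = a^H h and r is the variance of the effective noise; under the power constraint
  r \<ge> a^H B a, so a Cauchy-Schwarz inequality weighted by B bounds the ratio by h^H B^{-1} h, which
  the gain B^{-1} h, scaled to full power, attains. The normalized gain depends on the diagonal of B
  only up to a positive factor and depends on it continuously, so both regimes follow from the limit
  of B, respectively of (PT / sw^2) B.
\<close>

section \<open>Diagonal matrices and their quadratic forms\<close>

lemma diag_mat_mult_vec: "(diag_mat d *v x) $ i = d $ i * x $ i"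
  by (simp add: diag_mat_def matrix_vector_mult_def if_distrib[of "\<lambda>u. u * _"] sum.delta' cong: if_cong)

lemma diag_mat_mult: "diag_mat c ** diag_mat d = diag_mat (\<chi> i. c $ i * d $ i)"
  by (simp add: diag_mat_def matrix_matrix_mult_def vec_eq_iff
      if_distrib[of "\<lambda>u. u * _"] sum.delta' cong: if_cong)

text \<open>\<open>matrix_inv\<close> is a Hilbert choice among two-sided inverses. As
  \<open>B\<close> is one, the chosen matrix satisfies the specification, and associativity forces
  it to be \<open>B\<close>.\<close>

lemma matrix_inv_unique:
  fixes A :: "'a::semiring_1^'n^'m"
  assumes "A ** B = mat 1" "B ** A = mat 1"
  shows "matrix_inv A = B"
proof -
  have "A ** matrix_inv A = mat 1 \<and> matrix_inv A ** A = mat 1"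
    unfolding matrix_inv_def by (rule someI[of _ B]) (simp add: assms)
  then show ?thesis
    by (metis assms(2) matrix_mul_assoc matrix_mul_lid matrix_mul_rid)
qed

lemma matrix_inv_diag_mat:
  assumes "\<And>i. d $ i \<noteq> 0"
  shows "matrix_inv (diag_mat d) = diag_mat (\<chi> i. inverse (d $ i))"
proof -
  have one: "mat 1 = diag_mat (\<chi> i. 1)"
    by (simp add: mat_def diag_mat_def vec_eq_iff)
  show ?thesis
    by (rule matrix_inv_unique) (simp_all add: diag_mat_mult one assms)
qed

lemma conj_transpose_diag_mat: "conj_transpose (diag_mat d) = diag_mat (\<chi> i. cnj (d $ i))"
  by (simp add: conj_transpose_def diag_mat_def vec_eq_iff)

lemma of_real_cmod_square: "(complex_of_real (cmod z))\<^sup>2 = z * cnj z"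
  using complex_norm_square[of z] by simp

text \<open>Every quadratic form in the development has a real diagonal matrix, so each becomes a
  real sum here and the complex inequalities turn into real ones.\<close>

lemma hdot_diag_mat_of_real:
  "hdot x (diag_mat (\<chi> i. of_real (d i)) *v x) = of_real (\<Sum>i\<in>UNIV. (cmod (x $ i))\<^sup>2 * d i)"
  by (simp add: hdot_def diag_mat_mult_vec of_real_cmod_square mult_ac)

lemma HVH_mat_eq_diag_mat:
  "HVH_mat sv h = diag_mat (\<chi> i. of_real ((cmod (h $ i))\<^sup>2 * (sv $ i)\<^sup>2))"
  by (simp add: HVH_mat_def V_mat_def conj_transpose_diag_mat diag_mat_mult of_real_cmod_square mult_ac)

text \<open>The noise level and the power budget enter B only through their quotient
  \<open>sw\<^sup>2 / PT\<close>, which the parameter \<open>s\<close> represents. Both regimes are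
  limits in \<open>s\<close>.\<close>

definition B_diag :: "real \<Rightarrow> real^'n \<Rightarrow> complex^'n \<Rightarrow> real \<Rightarrow> 'n \<Rightarrow> real" where
  "B_diag st sv h s i = (cmod (h $ i))\<^sup>2 * (sv $ i)\<^sup>2 + s * (st\<^sup>2 + (sv $ i)\<^sup>2)"

lemma B_mat_eq_diag_mat:
  "B_mat st sv h sw PT = diag_mat (\<chi> i. of_real (B_diag st sv h (sw\<^sup>2 / PT) i))"
  by (simp add: B_mat_def HVH_mat_eq_diag_mat D_mat_def diag_mat_def vec_eq_iff B_diag_def
      scaleR_conv_of_real[where 'a=complex])

lemma B_diag_pos:
  assumes "st > 0" "s > 0"
  shows "B_diag st sv h s i > 0"
  unfolding B_diag_def using assms
  by (intro add_nonneg_pos mult_pos_pos add_pos_nonneg) auto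

lemma matrix_inv_diag_mat_of_real:
  fixes d :: "'n::finite \<Rightarrow> real"
  assumes "\<And>i. d i > 0"
  shows "matrix_inv (diag_mat (\<chi> i. of_real (d i)))
    = diag_mat (\<chi> i. complex_of_real (inverse (d i)))"
proof -
  have "d i \<noteq> 0" for i using assms[of i] by simp
  then show ?thesis by (subst matrix_inv_diag_mat) simp_all
qed

lemma hdot_matrix_inv_diag_mat_of_real:
  assumes "\<And>i. d i > 0"
  shows "hdot h (matrix_inv (diag_mat (\<chi> i. of_real (d i))) *v h)
    = of_real (\<Sum>i\<in>UNIV. (cmod (h $ i))\<^sup>2 / d i)"
  using assms by (simp only: matrix_inv_diag_mat_of_real hdot_diag_mat_of_real divide_inverse)

section \<open>Normalized gains for an arbitrary diagonal weight\<close>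

text \<open>With W the diagonal matrix of \<open>w\<close>, this is W^{-1} h, and the sum under the
  root is h^H W^{-1} D W^{-1} h. Taking W to be B, H V H^H or D yields the optimal gain, the
  high-SNR gain and the low-SNR limit.\<close>

definition matched_gain ::
  "real \<Rightarrow> real^'n \<Rightarrow> complex^'n \<Rightarrow> real \<Rightarrow> ('n \<Rightarrow> real) \<Rightarrow> complex^'n" where
  "matched_gain st sv h PT w =
     sqrt (PT / (\<Sum>i\<in>UNIV. (cmod (h $ i))\<^sup>2 * (st\<^sup>2 + (sv $ i)\<^sup>2) / (w i)\<^sup>2))
       *\<^sub>R (\<chi> i. h $ i / of_real (w i))"

text \<open>No term is negative, and one nonzero channel contributes a positive term. This makes the
  normalization of \<open>matched_gain\<close> meaningful.\<close>

lemma matched_power_sum_pos: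
  fixes h :: "complex^'n" and w :: "'n \<Rightarrow> real"
  assumes "h \<noteq> 0" "st > 0" "\<And>i. w i > 0"
  shows "(\<Sum>i\<in>UNIV. (cmod (h $ i))\<^sup>2 * (st\<^sup>2 + (sv $ i)\<^sup>2) / (w i)\<^sup>2) > 0"
proof -
  obtain k where "h $ k \<noteq> 0" using assms(1) by (auto simp: vec_eq_iff)
  moreover have "st\<^sup>2 + (sv $ i)\<^sup>2 > 0" for i using assms(2) by (simp add: add_pos_nonneg)
  ultimately show ?thesis
    by (intro sum_pos2[of UNIV k]) (use assms(3)[of k] in \<open>auto intro!: divide_pos_pos\<close>)
qed

lemma opt_gain_eq_matched_gain:
  assumes "st > 0" "sw > 0" "PT > 0"
  shows "opt_gain st sv h sw PT = matched_gain st sv h PT (B_diag st sv h (sw\<^sup>2 / PT))"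
proof -
  define w where "w = B_diag st sv h (sw\<^sup>2 / PT)"
  have w: "w i > 0" for i
    unfolding w_def using assms by (intro B_diag_pos) auto
  have eq: "diag_mat (\<chi> i. complex_of_real (inverse (w i))) ** D_mat st sv
      ** diag_mat (\<chi> i. complex_of_real (inverse (w i)))
    = diag_mat (\<chi> i. of_real ((st\<^sup>2 + (sv $ i)\<^sup>2) / (w i)\<^sup>2))"
    unfolding D_mat_def diag_mat_mult
    by (simp add: power2_eq_square divide_inverse mult_ac)
  show ?thesis
    unfolding opt_gain_def Let_def B_mat_eq_diag_mat w_def[symmetric] matrix_inv_diag_mat_of_real[OF w]
      matched_gain_def eq hdot_diag_mat_of_real Re_complex_of_real
    by (simp add: vec_eq_iff diag_mat_mult_vec divide_inverse[where 'a=complex]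
        mult.commute[where 'a=complex])
qed

text \<open>The vector shrinks by the factor \<open>s\<close> while the power sum shrinks by its
  square, so the root restores the factor. At low SNR this allows B, whose diagonal grows without
  bound, to be replaced by its convergent multiple (PT / sw^2) B.\<close>

lemma matched_gain_scale:
  assumes "s > 0"
  shows "matched_gain st sv h PT (\<lambda>i. s * w i) = matched_gain st sv h PT w"
proof -
  define S where "S = (\<Sum>i\<in>UNIV. (cmod (h $ i))\<^sup>2 * (st\<^sup>2 + (sv $ i)\<^sup>2) / (w i)\<^sup>2)"
  have S: "(\<Sum>i\<in>UNIV. (cmod (h $ i))\<^sup>2 * (st\<^sup>2 + (sv $ i)\<^sup>2) / (s * w i)\<^sup>2) = S / s\<^sup>2"
    unfolding S_def sum_divide_distrib by (simp add: power_mult_distrib mult_ac)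
  have "sqrt (PT / (S / s\<^sup>2)) = s * sqrt (PT / S)"
    using assms by (simp add: real_sqrt_mult real_sqrt_divide)
  then show ?thesis
    unfolding matched_gain_def S using assms
    by (simp add: vec_eq_iff S_def scaleR_conv_of_real[where 'a=complex])
qed

text \<open>Both the entries and the terms of the sum are fractions extended by a factor built from
  \<open>h $ i\<close>. Where \<open>h $ i\<close> is zero, both forms are zero because x / 0 =
  0.\<close>

lemma high_snr_gain_eq_matched_gain:
  "high_snr_gain st sv h PT = matched_gain st sv h PT (\<lambda>i. (cmod (h $ i))\<^sup>2 * (sv $ i)\<^sup>2)"
proof -
  have "cnj (1 / (h $ i * of_real ((sv $ i)\<^sup>2)))
      = h $ i / of_real ((cmod (h $ i))\<^sup>2 * (sv $ i)\<^sup>2)" for i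
    by (cases "h $ i = 0") (simp_all add: of_real_cmod_square)
  moreover have "(st\<^sup>2 + (sv $ i)\<^sup>2) / ((sv $ i) ^ 4 * (cmod (h $ i))\<^sup>2)
      = (cmod (h $ i))\<^sup>2 * (st\<^sup>2 + (sv $ i)\<^sup>2) / ((cmod (h $ i))\<^sup>2 * (sv $ i)\<^sup>2)\<^sup>2" for i
  proof -
    have "((cmod (h $ i))\<^sup>2 * (sv $ i)\<^sup>2)\<^sup>2 = (cmod (h $ i))\<^sup>2 * ((sv $ i) ^ 4 * (cmod (h $ i))\<^sup>2)"
      by (simp add: eval_nat_numeral)
    then show ?thesis by simp
  qed
  ultimately show ?thesis
    unfolding high_snr_gain_def matched_gain_def by presburger
qed

text \<open>Separates the dependence on \<open>PT\<close>, leaving a factor that is constant along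
  the filter.\<close>

lemma matched_gain_low_snr:
  "matched_gain st sv h PT (\<lambda>i. st\<^sup>2 + (sv $ i)\<^sup>2)
    = (sqrt (1 / (\<Sum>i\<in>UNIV. (cmod (h $ i))\<^sup>2 * (st\<^sup>2 + (sv $ i)\<^sup>2) / (st\<^sup>2 + (sv $ i)\<^sup>2)\<^sup>2))
        * sqrt PT) *\<^sub>R low_snr_direction st sv h"
  by (simp add: matched_gain_def low_snr_direction_def real_sqrt_divide)

text \<open>Squaring removes the root, since the sum is nonnegative. Each sensor thus gets the
  fraction of \<open>PT\<close> that its own term has in the power sum.\<close>

lemma sensor_power_matched_gain:
  assumes "PT > 0"
  shows "sensor_power st sv (matched_gain st sv h PT w) i
    = PT / (\<Sum>i\<in>UNIV. (cmod (h $ i))\<^sup>2 * (st\<^sup>2 + (sv $ i)\<^sup>2) / (w i)\<^sup>2)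
        * ((cmod (h $ i))\<^sup>2 * (st\<^sup>2 + (sv $ i)\<^sup>2) / (w i)\<^sup>2)"
proof -
  have "(\<Sum>i\<in>UNIV. (cmod (h $ i))\<^sup>2 * (st\<^sup>2 + (sv $ i)\<^sup>2) / (w i)\<^sup>2) \<ge> 0"
    by (intro sum_nonneg) auto
  then show ?thesis using assms
    by (simp add: sensor_power_def matched_gain_def norm_divide power_mult_distrib power_divide
        del: times_divide_eq_right times_divide_eq_left) simp
qed

text \<open>The factor \<open>PT\<close> over the power sum is positive and common to both sensors,
  so it cancels.\<close>

lemma sensor_power_matched_gain_less_iff:
  fixes h :: "complex^'n" and w :: "'n \<Rightarrow> real"
  assumes "h \<noteq> 0" "st > 0" "PT > 0" "\<And>i. w i > 0"
  shows "sensor_power st sv (matched_gain st sv h PT w) j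
      < sensor_power st sv (matched_gain st sv h PT w) i
    \<longleftrightarrow> (cmod (h $ j))\<^sup>2 * (st\<^sup>2 + (sv $ j)\<^sup>2) / (w j)\<^sup>2
      < (cmod (h $ i))\<^sup>2 * (st\<^sup>2 + (sv $ i)\<^sup>2) / (w i)\<^sup>2"
  unfolding sensor_power_matched_gain[OF assms(3)]
  by (intro mult_less_cancel_left_pos divide_pos_pos assms matched_power_sum_pos)

section \<open>Passing to the limit in the weights\<close>

text \<open>\<open>PT\<close> may vary without converging, so the gains need not have a limit. Their
  entrywise ratio, however, is free of \<open>PT\<close> and continuous in the weights at
  \<open>w0\<close>. Entries with \<open>h $ i = 0\<close> vanish on both sides, and asymptotic
  equivalence counts 0 / 0 as 1.\<close>

lemma asymp_equiv_matched_gain: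
  fixes h :: "complex^'n" and w :: "'b \<Rightarrow> 'n \<Rightarrow> real"
  assumes "h \<noteq> 0" "st > 0" "\<And>x. PT x > 0" "\<And>i. w0 i > 0"
    and "\<And>i. ((\<lambda>x. w x i) \<longlongrightarrow> w0 i) F"
  shows "(\<lambda>x. matched_gain st sv h (PT x) (w x) $ i)
    \<sim>[F] (\<lambda>x. matched_gain st sv h (PT x) w0 $ i)"
proof (cases "h $ i = 0")
  case True
  then show ?thesis by (simp add: matched_gain_def)
next
  case False
  define S where "S v = (\<Sum>i\<in>UNIV. (cmod (h $ i))\<^sup>2 * (st\<^sup>2 + (sv $ i)\<^sup>2) / (v i)\<^sup>2)" for v
  have S0: "S w0 > 0"
    unfolding S_def using assms by (intro matched_power_sum_pos)
  have w0: "w0 k \<noteq> 0" for k using assms(4)[of k] by simp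
  have nz: "matched_gain st sv h (PT x) w0 $ i \<noteq> 0" for x
    using False S0 w0[of i] assms(3)[of x] by (simp add: matched_gain_def S_def)
  \<comment> \<open>The roots of \<open>PT x\<close> cancel. Where \<open>w x i\<close> or
    \<open>S (w x)\<close> is zero, both sides are zero.\<close>
  have ratio: "matched_gain st sv h (PT x) (w x) $ i / matched_gain st sv h (PT x) w0 $ i
      = of_real (sqrt (S w0 / S (w x)) * (w0 i / w x i))" for x
    using False S0 w0[of i] assms(3)[of x]
    by (simp add: matched_gain_def flip: S_def)
       (simp add: real_sqrt_divide scaleR_conv_of_real)
  have "((\<lambda>x. S (w x)) \<longlongrightarrow> S w0) F"
    unfolding S_def using w0 by (intro tendsto_intros assms(5)) auto
  then have "((\<lambda>x. sqrt (S w0 / S (w x)) * (w0 i / w x i)) \<longlongrightarrow> sqrt (S w0 / S w0) * (w0 i / w0 i)) F"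
    using S0 w0 by (intro tendsto_intros assms(5)) auto
  then have "((\<lambda>x. sqrt (S w0 / S (w x)) * (w0 i / w x i)) \<longlongrightarrow> 1) F"
    using S0 w0[of i] by simp
  then have "((\<lambda>x. complex_of_real (sqrt (S w0 / S (w x)) * (w0 i / w x i))) \<longlongrightarrow> of_real 1) F"
    by (rule tendsto_of_real)
  then show ?thesis
    by (intro asymp_equivI') (simp only: ratio of_real_1)
qed

text \<open>The comparison of powers amounts to a comparison of terms free of \<open>PT\<close>.
  These converge, and a strict inequality between the limits holds eventually before the
  limit.\<close>

lemma eventually_sensor_power_matched_gain_less:
  fixes h :: "complex^'n" and w :: "'b \<Rightarrow> 'n \<Rightarrow> real"
  assumes "h \<noteq> 0" "st > 0" "\<And>x. PT x > 0" "\<And>i. w0 i > 0"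
    and "\<And>x i. w x i > 0" and "\<And>i. ((\<lambda>x. w x i) \<longlongrightarrow> w0 i) F"
    and "(cmod (h $ j))\<^sup>2 * (st\<^sup>2 + (sv $ j)\<^sup>2) / (w0 j)\<^sup>2
      < (cmod (h $ i))\<^sup>2 * (st\<^sup>2 + (sv $ i)\<^sup>2) / (w0 i)\<^sup>2"
  shows "\<forall>\<^sub>F x in F. sensor_power st sv (matched_gain st sv h (PT x) (w x)) j
      < sensor_power st sv (matched_gain st sv h (PT x) (w x)) i"
proof -
  have lim: "((\<lambda>x. (cmod (h $ k))\<^sup>2 * (st\<^sup>2 + (sv $ k)\<^sup>2) / (w x k)\<^sup>2) \<longlongrightarrow>
      (cmod (h $ k))\<^sup>2 * (st\<^sup>2 + (sv $ k)\<^sup>2) / (w0 k)\<^sup>2) F" for k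
    using assms(4)[of k] by (intro tendsto_intros assms(6)) auto
  show ?thesis
    using order_tendstoD[OF tendsto_diff[OF lim[of i] lim[of j]], of 0] assms(7)
    by (auto simp: sensor_power_matched_gain_less_iff[OF assms(1-3,5)])
qed

section \<open>Kalman error and optimality of the gain\<close>

text \<open>With q the innovation variance |c|^2 p + r, one has 1 - k c = r / q and |k| = p |c| / q,
  and the two error contributions add up to r p q / q^2. Dividing through by r gives p / (1 + p
  |c|^2 / r), which depends on the gains only through |c|^2 / r.\<close>

lemma update_mse_kalman_gain:
  assumes "p > 0" "r > 0"
  shows "update_mse p c r (kalman_gain p c r) = p * r / ((cmod c)\<^sup>2 * p + r)"
proof -
  define q where "q = (cmod c)\<^sup>2 * p + r"
  have q: "q > 0" unfolding q_def using assms by (simp add: add_nonneg_pos)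
  have "1 - kalman_gain p c r * c = of_real (1 - p * (cmod c)\<^sup>2 / q)"
    unfolding kalman_gain_def q_def[symmetric]
    by (simp add: of_real_cmod_square mult_ac)
  also have "1 - p * (cmod c)\<^sup>2 / q = r / q"
    using q by (simp add: q_def field_simps)
  finally have "cmod (1 - kalman_gain p c r * c) = r / q"
    using q assms by (simp only: norm_of_real) simp
  moreover have "cmod (kalman_gain p c r) = p * cmod c / q"
    unfolding kalman_gain_def q_def[symmetric] using q assms
    by (simp add: norm_mult norm_divide)
  ultimately have "update_mse p c r (kalman_gain p c r)
      = (r\<^sup>2 * p + (p * cmod c)\<^sup>2 * r) / q\<^sup>2"
    unfolding update_mse_def by (simp add: power_divide add_divide_distrib)
  also have "r\<^sup>2 * p + (p * cmod c)\<^sup>2 * r = r * p * q"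
    by (simp add: q_def power2_eq_square algebra_simps)
  finally show ?thesis
    unfolding q_def[symmetric] using q by (simp add: power2_eq_square mult_ac)
qed

lemma Re_hdot_HVH:
  "Re (hdot a (HVH_mat sv h *v a))
    = (\<Sum>i\<in>UNIV. (cmod (a $ i))\<^sup>2 * ((cmod (h $ i))\<^sup>2 * (sv $ i)\<^sup>2))"
  unfolding HVH_mat_eq_diag_mat hdot_diag_mat_of_real by simp

lemma sum_power_eq: "sum_power st sv a = of_real (\<Sum>i\<in>UNIV. sensor_power st sv a i)"
  unfolding sum_power_def D_mat_def hdot_diag_mat_of_real sensor_power_def ..

lemma sum_power_matched_gain:
  fixes h :: "complex^'n" and w :: "'n \<Rightarrow> real"
  assumes "h \<noteq> 0" "st > 0" "PT > 0" "\<And>i. w i > 0"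
  shows "sum_power st sv (matched_gain st sv h PT w) = of_real PT"
  using matched_power_sum_pos[of h st w sv, OF assms(1,2,4)] assms(3)
  by (simp only: sum_power_eq sensor_power_matched_gain flip: sum_distrib_left) simp

text \<open>After the triangle inequality, the real Cauchy-Schwarz inequality is applied to |a_i|
  sqrt(b_i) and |h_i| / sqrt(b_i), whose products are |a_i| |h_i|.\<close>

lemma weighted_Cauchy_Schwarz:
  assumes "\<And>i. b i > 0"
  shows "(cmod (hdot a h))\<^sup>2
    \<le> (\<Sum>i\<in>UNIV. (cmod (a $ i))\<^sup>2 * b i) * (\<Sum>i\<in>UNIV. (cmod (h $ i))\<^sup>2 / b i)"
proof -
  have b: "b i > 0" "b i \<ge> 0" for i using assms[of i] by auto
  have "cmod (hdot a h) \<le> (\<Sum>i\<in>UNIV. cmod (a $ i) * cmod (h $ i))"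
    unfolding hdot_def by (rule order_trans[OF norm_sum]) (simp add: norm_mult)
  also have "\<dots> = (\<Sum>i\<in>UNIV. (cmod (a $ i) * sqrt (b i)) * (cmod (h $ i) / sqrt (b i)))"
    using b by (intro sum.cong) (auto simp: less_imp_neq[symmetric])
  finally have "(cmod (hdot a h))\<^sup>2
      \<le> (\<Sum>i\<in>UNIV. (cmod (a $ i) * sqrt (b i)) * (cmod (h $ i) / sqrt (b i)))\<^sup>2"
    by (intro power_mono) auto
  also have "\<dots> \<le> (\<Sum>i\<in>UNIV. (cmod (a $ i) * sqrt (b i))\<^sup>2) * (\<Sum>i\<in>UNIV. (cmod (h $ i) / sqrt (b i))\<^sup>2)"
    by (rule Cauchy_Schwarz_ineq_sum)
  finally show ?thesis
    using b by (simp add: power_mult_distrib power_divide)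
qed

text \<open>This explains the second summand of B: at full power the second term on the left is
  \<open>sw\<^sup>2\<close>, so a^H B a is exactly the variance of the effective noise.\<close>

lemma Re_hdot_HVH_add:
  assumes "PT > 0"
  shows "Re (hdot a (HVH_mat sv h *v a)) + sw\<^sup>2 / PT * (\<Sum>i\<in>UNIV. sensor_power st sv a i)
    = (\<Sum>i\<in>UNIV. (cmod (a $ i))\<^sup>2 * B_diag st sv h (sw\<^sup>2 / PT) i)"
  unfolding Re_hdot_HVH B_diag_def sensor_power_def sum_distrib_left sum.distrib[symmetric]
  by (simp add: algebra_simps)

lemma kalman_mse_eq:
  assumes "p > 0" "sw > 0"
  shows "kalman_mse sv h sw p a = p * (Re (hdot a (HVH_mat sv h *v a)) + sw\<^sup>2)
    / ((cmod (hdot a h))\<^sup>2 * p + (Re (hdot a (HVH_mat sv h *v a)) + sw\<^sup>2))"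
proof -
  have "Re (hdot a (HVH_mat sv h *v a)) + sw\<^sup>2 > 0"
    unfolding Re_hdot_HVH using assms by (intro add_nonneg_pos sum_nonneg) auto
  then show ?thesis
    using assms by (simp add: kalman_mse_def Let_def update_mse_kalman_gain)
qed

text \<open>The power constraint gives a^H B a \<le> r, and weighted Cauchy-Schwarz then gives |c|^2
  \<le> r Q with Q = h^H B^{-1} h. Inserting this bound into p r / (|c|^2 p + r) removes the
  dependence on \<open>a\<close>.\<close>

lemma kalman_mse_ge:
  assumes "st > 0" "p > 0" "sw > 0" "PT > 0" "sum_power st sv a \<le> of_real PT"
  shows "kalman_mse sv h sw p a
    \<ge> p / ((\<Sum>i\<in>UNIV. (cmod (h $ i))\<^sup>2 / B_diag st sv h (sw\<^sup>2 / PT) i) * p + 1)"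
proof -
  define Q where "Q = (\<Sum>i\<in>UNIV. (cmod (h $ i))\<^sup>2 / B_diag st sv h (sw\<^sup>2 / PT) i)"
  define r where "r = Re (hdot a (HVH_mat sv h *v a)) + sw\<^sup>2"
  have b: "B_diag st sv h (sw\<^sup>2 / PT) i > 0" for i
    using assms by (intro B_diag_pos) auto
  have Q: "Q \<ge> 0" unfolding Q_def using b by (intro sum_nonneg) (simp add: less_imp_le)
  have r: "r > 0"
    unfolding r_def Re_hdot_HVH using assms by (intro add_nonneg_pos sum_nonneg) auto
  have "(\<Sum>i\<in>UNIV. sensor_power st sv a i) \<le> PT"
    using assms(5) unfolding sum_power_eq by (simp add: less_eq_complex_def)
  then have "sw\<^sup>2 / PT * (\<Sum>i\<in>UNIV. sensor_power st sv a i) \<le> sw\<^sup>2 / PT * PT"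
    using assms by (intro mult_left_mono) auto
  then have "(\<Sum>i\<in>UNIV. (cmod (a $ i))\<^sup>2 * B_diag st sv h (sw\<^sup>2 / PT) i) \<le> r"
    unfolding Re_hdot_HVH_add[OF assms(4), symmetric] r_def using assms by simp
  then have "(cmod (hdot a h))\<^sup>2 \<le> r * Q"
    using weighted_Cauchy_Schwarz[of "B_diag st sv h (sw\<^sup>2 / PT)" a h, OF b] Q
    unfolding Q_def[symmetric] by (meson mult_right_mono order_trans)
  then have le: "(cmod (hdot a h))\<^sup>2 * p + r \<le> r * (Q * p + 1)"
    using assms(2) by (simp add: algebra_simps)
  \<comment> \<open>Extending by \<open>r\<close> gives both fractions the numerator
    \<open>p * r\<close>, so only the denominators remain to be compared.\<close>
  have "p / (Q * p + 1) = p * r / (r * (Q * p + 1))"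
    using r by simp
  also have "\<dots> \<le> p * r / ((cmod (hdot a h))\<^sup>2 * p + r)"
    using le r Q assms(2) by (intro divide_left_mono mult_pos_pos add_nonneg_pos) auto
  finally show ?thesis
    unfolding kalman_mse_eq[OF assms(2,3)] by (simp add: r_def Q_def)
qed

text \<open>The gain is k B^{-1} h, for which c = k Q and r = k^2 Q. Hence |c|^2 / r = Q, the case
  of equality in Cauchy-Schwarz.\<close>

lemma kalman_mse_opt_gain:
  fixes h :: "complex^'n"
  assumes "h \<noteq> 0" "st > 0" "p > 0" "sw > 0" "PT > 0"
  shows "kalman_mse sv h sw p (opt_gain st sv h sw PT)
    = p / ((\<Sum>i\<in>UNIV. (cmod (h $ i))\<^sup>2 / B_diag st sv h (sw\<^sup>2 / PT) i) * p + 1)"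
proof -
  define b where "b = B_diag st sv h (sw\<^sup>2 / PT)"
  define Q where "Q = (\<Sum>i\<in>UNIV. (cmod (h $ i))\<^sup>2 / b i)"
  define k where "k = sqrt (PT / (\<Sum>i\<in>UNIV. (cmod (h $ i))\<^sup>2 * (st\<^sup>2 + (sv $ i)\<^sup>2) / (b i)\<^sup>2))"
  define a where "a = opt_gain st sv h sw PT"
  have b: "b i > 0" for i
    unfolding b_def using assms by (intro B_diag_pos) auto
  then have b0: "b i \<noteq> 0" for i by (metis less_irrefl)
  have a: "a = matched_gain st sv h PT b"
    unfolding a_def b_def using assms by (intro opt_gain_eq_matched_gain)
  then have a_nth: "a $ i = of_real (k / b i) * h $ i" for i
    by (simp add: matched_gain_def k_def scaleR_conv_of_real[where 'a=complex])
  have k: "k > 0"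
    unfolding k_def using assms b by (simp add: matched_power_sum_pos)
  have Q: "Q > 0"
  proof -
    obtain l where "h $ l \<noteq> 0" using assms(1) by (auto simp: vec_eq_iff)
    then show ?thesis
      unfolding Q_def using b by (intro sum_pos2[of UNIV l]) (auto simp: less_imp_le)
  qed
  have c: "hdot a h = of_real (k * Q)"
    unfolding hdot_def a_nth Q_def sum_distrib_left of_real_sum
    by (intro sum.cong) (simp_all add: of_real_cmod_square mult_ac)
  \<comment> \<open>Using the whole budget is what turns r into a^H B a.\<close>
  have "(\<Sum>i\<in>UNIV. sensor_power st sv a i) = PT"
    using sum_power_matched_gain[of h st PT b sv] assms b
    unfolding a[symmetric] sum_power_eq of_real_eq_iff by blast
  then have "Re (hdot a (HVH_mat sv h *v a)) + sw\<^sup>2 = (\<Sum>i\<in>UNIV. (cmod (a $ i))\<^sup>2 * b i)"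
    using Re_hdot_HVH_add[OF assms(5), of a sv h sw st] assms(5) by (simp add: b_def)
  also have "\<dots> = k\<^sup>2 * Q"
    unfolding Q_def sum_distrib_left a_nth norm_mult norm_of_real using b0
    by (intro sum.cong) (auto simp: power_mult_distrib power_divide power2_eq_square)
  finally have r: "Re (hdot a (HVH_mat sv h *v a)) + sw\<^sup>2 = k\<^sup>2 * Q" .
  have "kalman_mse sv h sw p a = p * (k\<^sup>2 * Q) / ((k\<^sup>2 * Q) * (Q * p + 1))"
    unfolding kalman_mse_eq[OF assms(3,4)] r c norm_of_real
    by (simp add: power_mult_distrib power2_eq_square algebra_simps)
  also have "\<dots> = p / (Q * p + 1)"
    using k Q by simp
  finally show ?thesis by (simp add: a_def Q_def b_def)
qed

text \<open>The gain spends exactly \<open>PT\<close>, hence is feasible, and its error equals the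
  lower bound valid for every feasible gain.\<close>

lemma is_arg_min_opt_gain:
  fixes h :: "complex^'n"
  assumes "h \<noteq> 0" "st > 0" "p > 0" "sw > 0" "PT > 0"
  shows "is_arg_min (kalman_mse sv h sw p) (\<lambda>a. sum_power st sv a \<le> of_real PT)
    (opt_gain st sv h sw PT)"
proof -
  have "B_diag st sv h (sw\<^sup>2 / PT) i > 0" for i
    using assms by (intro B_diag_pos) auto
  then have "sum_power st sv (opt_gain st sv h sw PT) = of_real PT"
    using sum_power_matched_gain[OF assms(1,2,5)] assms by (simp only: opt_gain_eq_matched_gain)
  then show ?thesis
    using kalman_mse_ge[of st p sw PT sv _ h] kalman_mse_opt_gain[OF assms, of sv] assms
    by (auto simp: is_arg_min_def not_less)
qed

section \<open>Optimality and the two SNR regimes along an arbitrary filter\<close>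

theorem mainTheorem2:
  fixes h :: "complex^'n" and sv :: "real^'n" and st p :: real
    and F :: "'b filter" and sw PT :: "'b \<Rightarrow> real"
  assumes "h \<noteq> 0" and "st > 0" and "\<And>i. sv $ i > 0" and "p > 0"
    and "\<And>x. sw x > 0" and "\<And>x. PT x > 0"
  shows
    "(\<forall>x. is_arg_min (kalman_mse sv h (sw x) p)
            (\<lambda>a. sum_power st sv a \<le> of_real (PT x))
            (opt_gain st sv h (sw x) (PT x)))
     \<and>
     ((\<forall>i. h $ i \<noteq> 0) \<longrightarrow>
        (\<forall>x. hdot h (matrix_inv (B_mat st sv h (sw x) (PT x)) *v h)
             < hdot h (matrix_inv (HVH_mat sv h) *v h))
        \<and> hdot h (matrix_inv (HVH_mat sv h) *v h) = of_real (\<Sum>i\<in>UNIV. 1 / (sv $ i)\<^sup>2)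
        \<and> (((\<lambda>x. (sw x)\<^sup>2 / PT x) \<longlongrightarrow> 0) F \<longrightarrow>
             ((\<lambda>x. hdot h (matrix_inv (B_mat st sv h (sw x) (PT x)) *v h))
                \<longlongrightarrow> hdot h (matrix_inv (HVH_mat sv h) *v h)) F
             \<and> (\<forall>i. (\<lambda>x. opt_gain st sv h (sw x) (PT x) $ i)
                      \<sim>[F] (\<lambda>x. high_snr_gain st sv h (PT x) $ i))
             \<and> (\<forall>i j. cmod (h $ i) \<le> cmod (h $ j) \<and> sv $ i \<le> sv $ j
                      \<and> (cmod (h $ i) < cmod (h $ j) \<or> sv $ i < sv $ j) \<longrightarrow>
                  (\<forall>x. sensor_power st sv (high_snr_gain st sv h (PT x)) i
                       > sensor_power st sv (high_snr_gain st sv h (PT x)) j)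
                  \<and> (\<forall>\<^sub>F x in F. sensor_power st sv (opt_gain st sv h (sw x) (PT x)) i
                       > sensor_power st sv (opt_gain st sv h (sw x) (PT x)) j))))
     \<and>
     (filterlim (\<lambda>x. (sw x)\<^sup>2 / PT x) at_top F \<longrightarrow>
        ((\<lambda>x. (PT x / (sw x)\<^sup>2) *\<^sub>R B_mat st sv h (sw x) (PT x)) \<longlongrightarrow> D_mat st sv) F
        \<and> (\<exists>c>0. \<forall>i. (\<lambda>x. opt_gain st sv h (sw x) (PT x) $ i)
                 \<sim>[F] (\<lambda>x. ((c * sqrt (PT x)) *\<^sub>R low_snr_direction st sv h) $ i))
        \<and> (\<forall>i j. cmod (h $ i) > cmod (h $ j) \<and> sv $ i \<le> sv $ j \<longrightarrow>
             sensor_power st sv (low_snr_direction st sv h) i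
               > sensor_power st sv (low_snr_direction st sv h) j
             \<and> (\<forall>\<^sub>F x in F. sensor_power st sv (opt_gain st sv h (sw x) (PT x)) i
                  > sensor_power st sv (opt_gain st sv h (sw x) (PT x)) j)))"
proof (intro conjI impI allI)
  fix x
  show "is_arg_min (kalman_mse sv h (sw x) p) (\<lambda>a. sum_power st sv a \<le> of_real (PT x))
      (opt_gain st sv h (sw x) (PT x))"
    by (intro is_arg_min_opt_gain assms)
next
  define s where "s x = (sw x)\<^sup>2 / PT x" for x
  \<comment> \<open>The diagonal of H V H^H, to which the diagonal of B tends as \<open>s\<close>
    tends to 0.\<close>
  define g where "g i = (cmod (h $ i))\<^sup>2 * (sv $ i)\<^sup>2" for i
  have s: "s x > 0" for x using assms(5,6)[of x] by (simp add: s_def)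
  note b = B_diag_pos[OF assms(2) s, of sv h]
  have d: "st\<^sup>2 + (sv $ i)\<^sup>2 > 0" for i using assms(2) by (simp add: add_pos_nonneg)
  have opt: "opt_gain st sv h (sw x) (PT x) = matched_gain st sv h (PT x) (B_diag st sv h (s x))" for x
    unfolding s_def by (intro opt_gain_eq_matched_gain assms)

  \<comment> \<open>High SNR\<close>
  {
    assume h: "\<forall>i. h $ i \<noteq> 0"
    have g: "g i > 0" for i
      using h assms(3)[of i] by (simp add: g_def)
    have q: "hdot h (matrix_inv (B_mat st sv h (sw x) (PT x)) *v h)
        = of_real (\<Sum>i\<in>UNIV. (cmod (h $ i))\<^sup>2 / B_diag st sv h (s x) i)" for x
      unfolding B_mat_eq_diag_mat s_def[symmetric] by (intro hdot_matrix_inv_diag_mat_of_real b)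
    have q0: "hdot h (matrix_inv (HVH_mat sv h) *v h) = of_real (\<Sum>i\<in>UNIV. (cmod (h $ i))\<^sup>2 / g i)"
      unfolding HVH_mat_eq_diag_mat g_def[symmetric] by (intro hdot_matrix_inv_diag_mat_of_real g)
    show "hdot h (matrix_inv (HVH_mat sv h) *v h) = of_real (\<Sum>i\<in>UNIV. 1 / (sv $ i)\<^sup>2)"
      unfolding q0 g_def using h by simp
    show "hdot h (matrix_inv (B_mat st sv h (sw x) (PT x)) *v h)
        < hdot h (matrix_inv (HVH_mat sv h) *v h)" for x
    proof -
      have "(\<Sum>i\<in>UNIV. (cmod (h $ i))\<^sup>2 / B_diag st sv h (s x) i)
          < (\<Sum>i\<in>UNIV. (cmod (h $ i))\<^sup>2 / g i)"
      proof (intro sum_strict_mono)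
        fix i
        \<comment> \<open>B exceeds H V H^H by s D, whose diagonal is positive. As every
          \<open>h $ i\<close> is nonzero, each quotient drops strictly.\<close>
        have "g i < B_diag st sv h (s x) i"
          unfolding B_diag_def g_def using mult_pos_pos[OF s[of x] d[of i]] by simp
        then show "(cmod (h $ i))\<^sup>2 / B_diag st sv h (s x) i < (cmod (h $ i))\<^sup>2 / g i"
          using h g[of i] b[of x i] by (intro divide_strict_left_mono mult_pos_pos) auto
      qed auto
      then show ?thesis
        unfolding q q0 by (simp add: less_complex_def)
    qed
    have power_less: "(cmod (h $ j))\<^sup>2 * (st\<^sup>2 + (sv $ j)\<^sup>2) / (g j)\<^sup>2
        < (cmod (h $ i))\<^sup>2 * (st\<^sup>2 + (sv $ i)\<^sup>2) / (g i)\<^sup>2"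
      if ij: "cmod (h $ i) \<le> cmod (h $ j) \<and> sv $ i \<le> sv $ j
        \<and> (cmod (h $ i) < cmod (h $ j) \<or> sv $ i < sv $ j)" for i j
    proof -
      \<comment> \<open>In this form the numerator decreases with the measurement noise, while
        \<open>g\<close> increases with both the channel gain and the noise.\<close>
      have eq: "(cmod (h $ k))\<^sup>2 * (st\<^sup>2 + (sv $ k)\<^sup>2) / (g k)\<^sup>2
          = (st\<^sup>2 / (sv $ k)\<^sup>2 + 1) / g k" for k
        using h assms(3)[of k] by (simp add: g_def field_simps power2_eq_square)
      have v: "sv $ i > 0" "sv $ j > 0" using assms(3) by auto
      have c: "cmod (h $ i) > 0" "cmod (h $ j) > 0" using h by auto
      have "g i < g j"
      \<comment> \<open>One of the two factors of \<open>g\<close> must grow strictly. If it is not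
        the channel gain, it is the noise.\<close>
      proof (cases "cmod (h $ i) < cmod (h $ j)")
        case True
        then show ?thesis unfolding g_def using ij v c
          by (intro mult_less_le_imp_less power_strict_mono power_mono) auto
      next
        case False
        then show ?thesis unfolding g_def using ij v c
          by (intro mult_le_less_imp_less power_strict_mono power_mono) auto
      qed
      moreover have "st\<^sup>2 / (sv $ j)\<^sup>2 \<le> st\<^sup>2 / (sv $ i)\<^sup>2"
        using ij v by (intro divide_left_mono power_mono mult_pos_pos) auto
      ultimately show ?thesis
        unfolding eq using g[of i] by (intro frac_less2 add_nonneg_pos) auto
    qed
    show "sensor_power st sv (high_snr_gain st sv h (PT x)) j
        < sensor_power st sv (high_snr_gain st sv h (PT x)) i"
      if "cmod (h $ i) \<le> cmod (h $ j) \<and> sv $ i \<le> sv $ j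
        \<and> (cmod (h $ i) < cmod (h $ j) \<or> sv $ i < sv $ j)" for x i j
      unfolding high_snr_gain_eq_matched_gain g_def[symmetric]
      using power_less[OF that] by (simp add: sensor_power_matched_gain_less_iff assms g)
    assume "((\<lambda>x. (sw x)\<^sup>2 / PT x) \<longlongrightarrow> 0) F"
    then have "((\<lambda>x. s x) \<longlongrightarrow> 0) F" by (simp add: s_def)
    then have "((\<lambda>x. g i + s x * (st\<^sup>2 + (sv $ i)\<^sup>2)) \<longlongrightarrow> g i + 0 * (st\<^sup>2 + (sv $ i)\<^sup>2)) F" for i
      by (intro tendsto_intros)
    then have lim: "((\<lambda>x. B_diag st sv h (s x) i) \<longlongrightarrow> g i) F" for i
      by (simp add: B_diag_def g_def)
    show "((\<lambda>x. hdot h (matrix_inv (B_mat st sv h (sw x) (PT x)) *v h))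
        \<longlongrightarrow> hdot h (matrix_inv (HVH_mat sv h) *v h)) F"
      unfolding q q0 using g by (intro tendsto_intros lim) (metis less_irrefl)
    show "(\<lambda>x. opt_gain st sv h (sw x) (PT x) $ i) \<sim>[F] (\<lambda>x. high_snr_gain st sv h (PT x) $ i)" for i
      unfolding opt high_snr_gain_eq_matched_gain g_def[symmetric]
      by (intro asymp_equiv_matched_gain assms g lim)
    show "\<forall>\<^sub>F x in F. sensor_power st sv (opt_gain st sv h (sw x) (PT x)) j
        < sensor_power st sv (opt_gain st sv h (sw x) (PT x)) i"
      if "cmod (h $ i) \<le> cmod (h $ j) \<and> sv $ i \<le> sv $ j
        \<and> (cmod (h $ i) < cmod (h $ j) \<or> sv $ i < sv $ j)" for i j
      unfolding opt
      by (rule eventually_sensor_power_matched_gain_less[OF assms(1,2,6) g b lim power_less[OF that]])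
  }

  \<comment> \<open>Low SNR\<close>
  have power_less: "(cmod (h $ j))\<^sup>2 * (st\<^sup>2 + (sv $ j)\<^sup>2) / (st\<^sup>2 + (sv $ j)\<^sup>2)\<^sup>2
      < (cmod (h $ i))\<^sup>2 * (st\<^sup>2 + (sv $ i)\<^sup>2) / (st\<^sup>2 + (sv $ i)\<^sup>2)\<^sup>2"
    if ij: "cmod (h $ i) > cmod (h $ j) \<and> sv $ i \<le> sv $ j" for i j
  proof -
    have eq: "(cmod (h $ k))\<^sup>2 * (st\<^sup>2 + (sv $ k)\<^sup>2) / (st\<^sup>2 + (sv $ k)\<^sup>2)\<^sup>2
        = (cmod (h $ k))\<^sup>2 / (st\<^sup>2 + (sv $ k)\<^sup>2)" for k
      using d[of k] by (simp add: power2_eq_square)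
    have "(sv $ i)\<^sup>2 \<le> (sv $ j)\<^sup>2"
      using ij assms(3)[of i] by (intro power_mono) auto
    then show ?thesis
      unfolding eq using d[of i] ij by (intro frac_less power_strict_mono) auto
  qed
  show "sensor_power st sv (low_snr_direction st sv h) j
      < sensor_power st sv (low_snr_direction st sv h) i"
    if "cmod (h $ j) < cmod (h $ i) \<and> sv $ i \<le> sv $ j" for i j
    \<comment> \<open>The direction is not normalized, so its sensor powers are the very terms
      compared in \<open>power_less\<close>.\<close>
    using power_less[OF that] d
    by (simp add: sensor_power_def low_snr_direction_def norm_divide power_divide
        flip: of_real_power of_real_add)
  \<comment> \<open>The diagonal of (PT / sw^2) B: the optimal gain is unchanged by the rescaling,
    and \<open>w\<close> now converges to the diagonal of D.\<close>
  define w where "w x i = 1 / s x * B_diag st sv h (s x) i" for x i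
  have w: "w x i > 0" for x i using s[of x] b[of x i] by (simp add: w_def)
  have optw: "opt_gain st sv h (sw x) (PT x) = matched_gain st sv h (PT x) (w x)" for x
    using matched_gain_scale[of "1 / s x" st sv h "PT x" "B_diag st sv h (s x)"] s[of x]
    unfolding opt w_def by simp
  assume "filterlim (\<lambda>x. (sw x)\<^sup>2 / PT x) at_top F"
  then have "((\<lambda>x. 1 / s x) \<longlongrightarrow> 0) F"
    unfolding s_def by (rule tendsto_divide_0[OF tendsto_const filterlim_at_top_imp_at_infinity])
  then have "((\<lambda>x. 1 / s x * g i + (st\<^sup>2 + (sv $ i)\<^sup>2)) \<longlongrightarrow> 0 * g i + (st\<^sup>2 + (sv $ i)\<^sup>2)) F" for i
    by (intro tendsto_intros)
  moreover have "w x i = 1 / s x * g i + (st\<^sup>2 + (sv $ i)\<^sup>2)" for x i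
    using s[of x] by (simp add: w_def B_diag_def g_def field_simps)
  ultimately have lim: "((\<lambda>x. w x i) \<longlongrightarrow> st\<^sup>2 + (sv $ i)\<^sup>2) F" for i
    by simp
  have "(PT x / (sw x)\<^sup>2) *\<^sub>R B_mat st sv h (sw x) (PT x) = diag_mat (\<chi> i. of_real (w x i))" for x
    unfolding B_mat_eq_diag_mat s_def[symmetric] w_def
    by (simp add: diag_mat_def vec_eq_iff s_def scaleR_conv_of_real[where 'a=complex])
  moreover have "((\<lambda>x. diag_mat (\<chi> i. of_real (w x i))) \<longlongrightarrow> D_mat st sv) F"
    unfolding D_mat_def diag_mat_def
  proof (intro vec_tendstoI, goal_cases)
    case (1 i j)
    then show ?case using tendsto_of_real[OF lim[of i]] by (cases "i = j") simp_all
  qed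
  ultimately show "((\<lambda>x. (PT x / (sw x)\<^sup>2) *\<^sub>R B_mat st sv h (sw x) (PT x)) \<longlongrightarrow> D_mat st sv) F"
    by simp
  show "\<exists>c>0. \<forall>i. (\<lambda>x. opt_gain st sv h (sw x) (PT x) $ i)
      \<sim>[F] (\<lambda>x. ((c * sqrt (PT x)) *\<^sub>R low_snr_direction st sv h) $ i)"
  proof (intro exI conjI allI)
    \<comment> \<open>The witness is the factor of \<open>sqrt PT\<close> in
      \<open>matched_gain_low_snr\<close>, that is 1 / sqrt(h^H D^{-1} h).\<close>
    show "sqrt (1 / (\<Sum>i\<in>UNIV. (cmod (h $ i))\<^sup>2 * (st\<^sup>2 + (sv $ i)\<^sup>2) / (st\<^sup>2 + (sv $ i)\<^sup>2)\<^sup>2)) > 0"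
      using matched_power_sum_pos[OF assms(1,2), of "\<lambda>i. st\<^sup>2 + (sv $ i)\<^sup>2" sv] d by simp
    show "(\<lambda>x. opt_gain st sv h (sw x) (PT x) $ i) \<sim>[F] (\<lambda>x.
        ((sqrt (1 / (\<Sum>i\<in>UNIV. (cmod (h $ i))\<^sup>2 * (st\<^sup>2 + (sv $ i)\<^sup>2) / (st\<^sup>2 + (sv $ i)\<^sup>2)\<^sup>2))
          * sqrt (PT x)) *\<^sub>R low_snr_direction st sv h) $ i)" for i
      unfolding optw matched_gain_low_snr[symmetric]
      by (intro asymp_equiv_matched_gain assms d lim)
  qed
  show "\<forall>\<^sub>F x in F. sensor_power st sv (opt_gain st sv h (sw x) (PT x)) j
      < sensor_power st sv (opt_gain st sv h (sw x) (PT x)) i"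
    if "cmod (h $ j) < cmod (h $ i) \<and> sv $ i \<le> sv $ j" for i j
    unfolding optw
    by (rule eventually_sensor_power_matched_gain_less[OF assms(1,2,6) d w lim power_less[OF that]])
qed

end
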